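(* Let $m\geq 3$, $n\geq 2$ and $0\leq l\leq n$. Then the chromatic number of the signed graph $(B(m,n),\sigma_l)$ is $2$ if $m$ is odd and $l=n$, is $2$ if $m$ is even and $l=0$, and is $3$ otherwise.
   Context: A signed graph $(G,\sigma)$ is a graph with a sign function $\sigma:E(G)\to\{1,-1\}$. A coloring in $2k+1$ signed colors is a map $c:V(G)\to\{-k,\ldots,-1,0,1,\ldots,k\}$; a zero-free coloring in $2k$ signed colors is a map $c:V(G)\to\{-k,\ldots,-1,1,\ldots,k\}$. A coloring is proper if $c(x)\neq\sigma(e)c(y)$ for every edge $e=xy$. The chromatic polynomial $\chi_\Sigma(\lambda)$ is the polynomial whose value at $\lambda=2k+1$ is the number of proper colorings in $2k+1$ signed colors, and the zero-free chromatic polynomial $\chi^b_\Sigma(\lambda)$ is the polynomial whose value at $\lambda=2k$ is the number of proper zero-free colorings in $2k$ signed colors. The chromatic number $\chi(\Sigma)$ is the minimum of $\{2k+1 : \chi_\Sigma(2k+1)>0\}\cup\{2r:\chi^b_\Sigma(2r)>0\}$. The book graph $B(m,n)$ has vertices $\{u,v\}\cup\{u_j^i:1\le i\le n, 1\le j\le m-2\}$ and consists of the $n$ cycles $u u_1^i\cdots u_{m-2}^i v u$ sharing the edge $uv$. Let $\sigma_0=\emptyset$ and, for $1\le l\le n$, $\sigma_l=\{uu_1^1,uu_1^2,\ldots,uu_1^l\}$ (the set of negative edges). *)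

theory Defs
  imports "HOL-Library.FuncSet" "HOL-Computational_Algebra.Polynomial"
begin

record 'v signed_graph =
  verts :: "'v set"
  edges :: "'v set set"
  sign :: "'v set \<Rightarrow> int"

text \<open>Finite simple graphs, an edge being the set of its two ends; the sign function is only
  relevant on edges.\<close>

definition is_signed_graph :: "('v, 'z) signed_graph_scheme \<Rightarrow> bool" where
  "is_signed_graph S \<longleftrightarrow>
     finite (verts S) \<and>
     edges S \<subseteq> {e. e \<subseteq> verts S \<and> card e = 2} \<and>
     (\<forall>e\<in>edges S. sign S e = 1 \<or> sign S e = -1)"

definition proper :: "('v, 'z) signed_graph_scheme \<Rightarrow> ('v \<Rightarrow> int) \<Rightarrow> bool" where
  "proper S c \<longleftrightarrow> (\<forall>x y. {x, y} \<in> edges S \<longrightarrow> c x \<noteq> sign S {x, y} * c y)"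

definition proper_colorings :: "('v, 'z) signed_graph_scheme \<Rightarrow> nat \<Rightarrow> ('v \<Rightarrow> int) set" where
  "proper_colorings S k = {c \<in> verts S \<rightarrow>\<^sub>E {- int k..int k}. proper S c}"

definition proper_zero_free_colorings ::
    "('v, 'z) signed_graph_scheme \<Rightarrow> nat \<Rightarrow> ('v \<Rightarrow> int) set" where
  "proper_zero_free_colorings S k = {c \<in> verts S \<rightarrow>\<^sub>E ({- int k..int k} - {0}). proper S c}"

text \<open>Both polynomials are unique, being prescribed at infinitely many points, and they exist
  for every finite signed graph: by inclusion-exclusion over the sets of violated edges, each count
  is an alternating sum of powers of the number of colors (or zeros).\<close>

definition chromatic_poly :: "('v, 'z) signed_graph_scheme \<Rightarrow> int poly" where
  "chromatic_poly S =
     (THE p. \<forall>k. poly p (2 * int k + 1) = int (card (proper_colorings S k)))"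

definition zero_free_chromatic_poly :: "('v, 'z) signed_graph_scheme \<Rightarrow> int poly" where
  "zero_free_chromatic_poly S =
     (THE p. \<forall>k. poly p (2 * int k) = int (card (proper_zero_free_colorings S k)))"

definition chromatic_number :: "('v, 'z) signed_graph_scheme \<Rightarrow> nat" where
  "chromatic_number S =
     (LEAST x. x \<in> {2 * k + 1 | k. poly (chromatic_poly S) (int (2 * k + 1)) > 0}
                 \<union> {2 * r | r. poly (zero_free_chromatic_poly S) (int (2 * r)) > 0})"

text \<open>\<open>Page i j\<close> is the vertex $u_j^i$, the \<open>j\<close>-th inner vertex of the \<open>i\<close>-th cycle.\<close>

datatype book_vertex = End_u | End_v | Page nat nat

definition book_verts :: "nat \<Rightarrow> nat \<Rightarrow> book_vertex set" where
  "book_verts m n = {End_u, End_v} \<union> {Page i j | i j. i \<in> {1..n} \<and> j \<in> {1..m - 2}}"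

text \<open>Intended for \<open>m \<ge> 3\<close>, so that every cycle has an inner vertex.\<close>

definition book_edges :: "nat \<Rightarrow> nat \<Rightarrow> book_vertex set set" where
  "book_edges m n =
     {{End_u, End_v}}
     \<union> {{End_u, Page i 1} | i. i \<in> {1..n}}
     \<union> {{Page i j, Page i (j + 1)} | i j. i \<in> {1..n} \<and> j \<in> {1..<m - 2}}
     \<union> {{Page i (m - 2), End_v} | i. i \<in> {1..n}}"

definition book_neg :: "nat \<Rightarrow> book_vertex set set" where
  "book_neg l = {{End_u, Page i 1} | i. i \<in> {1..l}}"

definition signed_book :: "nat \<Rightarrow> nat \<Rightarrow> nat \<Rightarrow> book_vertex signed_graph" where
  "signed_book m n l =
     \<lparr>verts = book_verts m n, edges = book_edges m n,
      sign = (\<lambda>e. if e \<in> book_neg l then -1 else 1)\<rparr>"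

lemma is_signed_graph_signed_book:
  assumes "m \<ge> 3"
  shows "is_signed_graph (signed_book m n l)"
proof -
  have "book_verts m n = {End_u, End_v} \<union> case_prod Page ` ({1..n} \<times> {1..m - 2})"
    by (auto simp: book_verts_def)
  then have "finite (book_verts m n)" by simp
  moreover have "e \<subseteq> book_verts m n \<and> card e = 2" if "e \<in> book_edges m n" for e
    using that assms by (auto simp: book_edges_def book_verts_def card_insert_if)
  ultimately show ?thesis
    by (auto simp: is_signed_graph_def signed_book_def)
qed

end

theory Submission
  imports Defs
begin

text \<open>Renaming colors by an odd involution preserves properness. Color the vertices one at a time:
  if the colors used so far have absolute value at most \<open>r\<close>, the next vertex gets either one of
  these, or one of the \<open>2 * (k - r)\<close> others, all of which are equivalent under such renamings. This
  gives polynomials with integer coefficients for both counts, so the chromatic number is determined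
  by the existence of colorings. With the colors \<open>-1\<close> and \<open>1\<close>, a positive edge changes the color
  and a negative edge keeps it, so such a coloring exists iff every cycle has an even number of
  positive edges. Coloring \<open>u\<close> with \<open>0\<close> removes this parity obstruction.\<close>

section \<open>Polynomiality of the number of colorings\<close>

text \<open>Taking \<open>Z\<close> to be \<open>{}\<close> or \<open>{0}\<close> lets one induction
  serve both the zero-free and the full count.\<close>

definition signed_colors :: "int set \<Rightarrow> nat \<Rightarrow> int set" where
  "signed_colors Z k = ({- int k..int k} - {0}) \<union> Z"

text \<open>Oddness makes a renaming commute with edge signs, and colors of absolute value at most
  \<open>r\<close> are those already used, so they stay put.\<close>

definition odd_involution :: "nat \<Rightarrow> (int \<Rightarrow> int) \<Rightarrow> bool" where
  "odd_involution r \<pi> \<longleftrightarrow>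
     (\<forall>x. \<pi> (\<pi> x) = x) \<and> (\<forall>x. \<pi> (- x) = - \<pi> x) \<and> (\<forall>x. \<bar>x\<bar> \<le> int r \<longrightarrow> \<pi> x = x)"

text \<open>Since the identity is an odd involution, this includes that \<open>Q\<close> only depends on the
  restriction of the coloring to \<open>V\<close>.\<close>

definition renaming_invariant :: "nat \<Rightarrow> 'v set \<Rightarrow> (('v \<Rightarrow> int) \<Rightarrow> bool) \<Rightarrow> bool" where
  "renaming_invariant r V Q \<longleftrightarrow>
     (\<forall>\<pi> c c'. odd_involution r \<pi> \<longrightarrow> (\<forall>x\<in>V. c' x = \<pi> (c x)) \<longrightarrow> Q c' = Q c)"

lemma renaming_invariantD:
  "renaming_invariant r V Q \<Longrightarrow> odd_involution r \<pi> \<Longrightarrow> (\<And>x. x \<in> V \<Longrightarrow> c' x = \<pi> (c x)) \<Longrightarrow> Q c' = Q c"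
  unfolding renaming_invariant_def by blast

lemma odd_involution_mono: "odd_involution s \<pi> \<Longrightarrow> r \<le> s \<Longrightarrow> odd_involution r \<pi>"
  unfolding odd_involution_def by auto

text \<open>Giving \<open>v\<close> the color \<open>j\<close> makes \<open>j\<close> a used color:
  renamings at level \<open>s\<close> fix it, so they also act correctly at
  \<open>v\<close>.\<close>

lemma renaming_invariant_update:
  assumes "renaming_invariant r (insert v V) Q" "r \<le> s" "\<bar>j\<bar> \<le> int s"
  shows "renaming_invariant s V (\<lambda>c. Q (c(v := j)))"
  unfolding renaming_invariant_def
proof (intro allI impI)
  fix \<pi> c c' assume pi: "odd_involution s \<pi>" and c: "\<forall>x\<in>V. c' x = \<pi> (c x)"
  have "\<pi> j = j" using pi assms(3) by (auto simp: odd_involution_def)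
  then show "Q (c'(v := j)) = Q (c(v := j))"
    using c by (intro renaming_invariantD[OF assms(1) odd_involution_mono[OF pi assms(2)]]) auto
qed

text \<open>Exchange \<open>a\<close> with \<open>b\<close> and, to stay odd, \<open>- a\<close>
  with \<open>- b\<close>; the order of the cases also covers \<open>b = a\<close> and
  \<open>b = - a\<close>.\<close>

lemma ex_odd_involution_swap:
  assumes "\<bar>a\<bar> > int r" "\<bar>b\<bar> > int r" "\<bar>a\<bar> \<le> int k" "\<bar>b\<bar> \<le> int k" "Z \<subseteq> {0}"
  obtains \<pi> where "odd_involution r \<pi>" "\<pi> a = b" "\<And>x. x \<in> signed_colors Z k \<Longrightarrow> \<pi> x \<in> signed_colors Z k"
proof
  define \<pi> where "\<pi> = (\<lambda>x. if x = a then b else if x = b then a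
    else if x = - a then - b else if x = - b then - a else x)"
  show "odd_involution r \<pi>" "\<pi> a = b" "\<And>x. x \<in> signed_colors Z k \<Longrightarrow> \<pi> x \<in> signed_colors Z k"
    using assms by (auto simp: odd_involution_def \<pi>_def signed_colors_def)
qed

lemma card_colorings_insert:
  assumes "finite V" "v \<notin> V" "finite K"
  shows "card {c \<in> insert v V \<rightarrow>\<^sub>E K. Q c} = (\<Sum>j\<in>K. card {c \<in> V \<rightarrow>\<^sub>E K. Q (c(v := j))})"
proof -
  have "bij_betw (\<lambda>(j, c). c(v := j)) (SIGMA j:K. {c \<in> V \<rightarrow>\<^sub>E K. Q (c(v := j))})
      {c \<in> insert v V \<rightarrow>\<^sub>E K. Q c}"
    unfolding bij_betw_def
  proof
    show "inj_on (\<lambda>(j, c). c(v := j)) (SIGMA j:K. {c \<in> V \<rightarrow>\<^sub>E K. Q (c(v := j))})"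
      by (rule inj_on_subset[OF inj_combinator[OF assms(2), of "\<lambda>_. K"]]) auto
    show "(\<lambda>(j, c). c(v := j)) ` (SIGMA j:K. {c \<in> V \<rightarrow>\<^sub>E K. Q (c(v := j))})
        = {c \<in> insert v V \<rightarrow>\<^sub>E K. Q c}"
      unfolding PiE_insert_eq by force
  qed
  then have "card {c \<in> insert v V \<rightarrow>\<^sub>E K. Q c}
      = card (SIGMA j:K. {c \<in> V \<rightarrow>\<^sub>E K. Q (c(v := j))})"
    by (simp add: bij_betw_same_card)
  also have "\<dots> = (\<Sum>j\<in>K. card {c \<in> V \<rightarrow>\<^sub>E K. Q (c(v := j))})"
    using assms by (intro card_SigmaI) (auto intro!: finite_PiE)
  finally show ?thesis .
qed

text \<open>Composition with \<open>\<pi>\<close> is its own inverse on colorings and moves the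
  color \<open>j\<close> at \<open>v\<close> to \<open>\<pi> j\<close>.\<close>

lemma card_colorings_renaming:
  assumes Q: "renaming_invariant r (insert v V) Q" and v: "v \<notin> V" and pi: "odd_involution r \<pi>"
    and K: "\<And>x. x \<in> K \<Longrightarrow> \<pi> x \<in> K"
  shows "card {c \<in> V \<rightarrow>\<^sub>E K. Q (c(v := j))} = card {c \<in> V \<rightarrow>\<^sub>E K. Q (c(v := \<pi> j))}"
proof (rule bij_betw_same_card)
  let ?f = "\<lambda>c. \<lambda>x\<in>V. \<pi> (c x)"
  have inv: "\<pi> (\<pi> x) = x" for x using pi by (simp add: odd_involution_def)
  have fwd: "Q ((?f c)(v := \<pi> i)) = Q (c(v := i))" for c i
    using v by (intro renaming_invariantD[OF Q pi]) auto
  show "bij_betw ?f {c \<in> V \<rightarrow>\<^sub>E K. Q (c(v := j))} {c \<in> V \<rightarrow>\<^sub>E K. Q (c(v := \<pi> j))}"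
  proof (rule bij_betw_byWitness[where f' = ?f])
    have ff: "?f (?f c) = c" if "c \<in> V \<rightarrow>\<^sub>E K" for c
      using that by (auto simp: inv fun_eq_iff PiE_def extensional_def)
    then show "\<forall>c\<in>{c \<in> V \<rightarrow>\<^sub>E K. Q (c(v := j))}. ?f (?f c) = c"
      "\<forall>c\<in>{c \<in> V \<rightarrow>\<^sub>E K. Q (c(v := \<pi> j))}. ?f (?f c) = c" by blast+
    have mem: "?f c \<in> V \<rightarrow>\<^sub>E K" if "c \<in> V \<rightarrow>\<^sub>E K" for c
      using that K by (auto simp: PiE_iff)
    then show "?f ` {c \<in> V \<rightarrow>\<^sub>E K. Q (c(v := j))} \<subseteq> {c \<in> V \<rightarrow>\<^sub>E K. Q (c(v := \<pi> j))}"
      using fwd by blast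
    have "Q ((?f c)(v := j)) = Q (c(v := \<pi> j))" for c
      using fwd[of c "\<pi> j"] by (simp only: inv)
    then show "?f ` {c \<in> V \<rightarrow>\<^sub>E K. Q (c(v := \<pi> j))} \<subseteq> {c \<in> V \<rightarrow>\<^sub>E K. Q (c(v := j))}"
      using mem by blast
  qed
qed

text \<open>A general \<open>Q\<close> allows the induction to absorb the colors already chosen into
  the predicate. The bound \<open>k \<ge> r\<close> ensures that all these colors are available.
  Using \<open>2 * int k\<close>, the number of nonzero colors, as argument keeps the coefficients
  integral.\<close>

lemma ex_poly_card_colorings:
  assumes "finite V" "Z \<subseteq> {0}" "renaming_invariant r V Q"
  shows "\<exists>p :: int poly. \<forall>k\<ge>r. poly p (2 * int k) = int (card {c \<in> V \<rightarrow>\<^sub>E signed_colors Z k. Q c})"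
  using assms(1,3)
proof (induction V arbitrary: r Q rule: finite_induct)
  case empty
  show ?case
    \<comment> \<open>On no vertices there is just one coloring, whatever the colors, so the count
      is constant.\<close>
    by (rule exI[of _ "[:int (card {c \<in> {} \<rightarrow>\<^sub>E ({} :: int set). Q c}):]"]) simp
next
  case (insert v V)
  let ?N = "\<lambda>k j. card {c \<in> V \<rightarrow>\<^sub>E signed_colors Z k. Q (c(v := j))}"
  have finZ: "finite Z" using assms(2) finite_subset by blast
  have fin: "finite (signed_colors Z k)" for k using finZ by (simp add: signed_colors_def)
  have "\<exists>p :: int poly. \<forall>k\<ge>r. poly p (2 * int k) = int (?N k j)" if "j \<in> signed_colors Z r" for j
  proof (rule insert.IH, rule renaming_invariant_update[OF insert.prems])
    show "\<bar>j\<bar> \<le> int r" using that assms(2) by (auto simp: signed_colors_def)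
  qed simp
  then obtain p :: "int \<Rightarrow> int poly" where
    p: "\<And>j k. j \<in> signed_colors Z r \<Longrightarrow> k \<ge> r \<Longrightarrow> poly (p j) (2 * int k) = int (?N k j)"
    using bchoice[of "signed_colors Z r" "\<lambda>j p. \<forall>k\<ge>r. poly p (2 * int k) = int (?N k j)"] by blast
  have "\<exists>q :: int poly. \<forall>k\<ge>Suc r. poly q (2 * int k) = int (?N k (int r + 1))"
    by (rule insert.IH, rule renaming_invariant_update[OF insert.prems]) auto
  then obtain q :: "int poly" where
    q: "\<And>k. k \<ge> Suc r \<Longrightarrow> poly q (2 * int k) = int (?N k (int r + 1))"
    by blast
  let ?P = "(\<Sum>j\<in>signed_colors Z r. p j) + [:- 2 * int r, 1:] * q"
  have "poly ?P (2 * int k) = int (card {c \<in> insert v V \<rightarrow>\<^sub>E signed_colors Z k. Q c})" if k: "k \<ge> r" for k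
  proof -
    let ?D = "{- int k..int k} - {- int r..int r}"
    have "signed_colors Z k = signed_colors Z r \<union> ?D" "signed_colors Z r \<inter> ?D = {}"
      using k assms(2) by (auto simp: signed_colors_def)
    then have split: "(\<Sum>j\<in>signed_colors Z k. ?N k j)
        = (\<Sum>j\<in>signed_colors Z r. ?N k j) + (\<Sum>j\<in>?D. ?N k j)"
      using fin by (simp add: sum.union_disjoint)
    have new: "?N k j = ?N k (int r + 1)" if "j \<in> ?D" for j
    proof -
      have "\<bar>j\<bar> > int r" "\<bar>j\<bar> \<le> int k" using that by auto
      then obtain \<pi> where pi: "odd_involution r \<pi>" "\<pi> j = int r + 1"
        and K: "\<And>x. x \<in> signed_colors Z k \<Longrightarrow> \<pi> x \<in> signed_colors Z k"
        using ex_odd_involution_swap[of r j "int r + 1" k Z] assms(2) by auto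
      show ?thesis
        using card_colorings_renaming[OF insert.prems insert.hyps(2) pi(1) K, of j] by (simp only: pi(2))
    qed
    have "card ?D = 2 * (k - r)"
      using k by (subst card_Diff_subset) auto
    then have "int (\<Sum>j\<in>?D. ?N k j) = (2 * int k - 2 * int r) * int (?N k (int r + 1))"
      using new k by (simp add: of_nat_diff)
    also have "\<dots> = (2 * int k - 2 * int r) * poly q (2 * int k)"
      \<comment> \<open>At \<open>k = r\<close> nothing is known about \<open>q\<close>, but the
        factor in front of it vanishes.\<close>
      using q[of k] k by (cases "k = r") auto
    finally show ?thesis
      using p k card_colorings_insert[OF insert.hyps fin[of k], of Q] split
      by (simp add: poly_sum left_diff_distrib)
  qed
  then show ?case by blast
qed

section \<open>The two chromatic polynomials\<close>

text \<open>An involution is injective, and an odd one commutes with both signs, so the condition at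
  each edge is unchanged. Level \<open>0\<close> means that no nonzero color has been used
  yet.\<close>

lemma renaming_invariant_proper:
  assumes "is_signed_graph S"
  shows "renaming_invariant 0 (verts S) (proper S)"
  unfolding renaming_invariant_def
proof (intro allI impI)
  fix \<pi> and c c' :: "'a \<Rightarrow> int"
  assume pi: "odd_involution 0 \<pi>" and c: "\<forall>x\<in>verts S. c' x = \<pi> (c x)"
  have eq: "\<pi> x = \<pi> y \<longleftrightarrow> x = y" for x y using pi by (metis odd_involution_def)
  have "c' x = sign S {x, y} * c' y \<longleftrightarrow> c x = sign S {x, y} * c y" if e: "{x, y} \<in> edges S" for x y
  proof -
    have "x \<in> verts S" "y \<in> verts S" "sign S {x, y} = 1 \<or> sign S {x, y} = -1"
      using e assms unfolding is_signed_graph_def by auto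
    moreover have "- \<pi> (c y) = \<pi> (- c y)" using pi by (simp add: odd_involution_def)
    ultimately show ?thesis using c by (auto simp: eq)
  qed
  then show "proper S c' = proper S c" by (auto simp: proper_def)
qed

text \<open>The difference would have infinitely many roots. This gives the uniqueness behind both
  definite descriptions.\<close>

lemma poly_eqI_infinite:
  fixes p q :: "'a :: {comm_ring_1, ring_no_zero_divisors} poly" and f :: "nat \<Rightarrow> 'a"
  assumes "inj f" "\<And>k. poly p (f k) = poly q (f k)"
  shows "p = q"
proof (rule ccontr)
  assume "p \<noteq> q"
  then have "finite {x. poly (p - q) x = 0}" by (intro poly_roots_finite) simp
  moreover have "range f \<subseteq> {x. poly (p - q) x = 0}" using assms(2) by auto
  ultimately show False using assms(1) finite_subset range_inj_infinite by blast
qed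

lemma poly_zero_free_chromatic_poly:
  assumes "is_signed_graph S"
  shows "poly (zero_free_chromatic_poly S) (2 * int k) = int (card (proper_zero_free_colorings S k))"
proof -
  have "finite (verts S)" using assms by (simp add: is_signed_graph_def)
  then obtain p :: "int poly" where
    "\<forall>k\<ge>0. poly p (2 * int k) = int (card {c \<in> verts S \<rightarrow>\<^sub>E signed_colors {} k. proper S c})"
    using ex_poly_card_colorings[OF _ _ renaming_invariant_proper[OF assms], of "{}"] by auto
  then have "\<forall>k. poly p (2 * int k) = int (card (proper_zero_free_colorings S k))"
    by (simp add: proper_zero_free_colorings_def signed_colors_def)
  then have "\<exists>!p. \<forall>k. poly p (2 * int k) = int (card (proper_zero_free_colorings S k))"
    by (intro ex1I[of _ p]) (auto intro!: poly_eqI_infinite[of "\<lambda>k. 2 * int k"] simp: inj_def)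
  from theI'[OF this] show ?thesis by (simp add: zero_free_chromatic_poly_def)
qed

lemma poly_chromatic_poly:
  assumes "is_signed_graph S"
  shows "poly (chromatic_poly S) (2 * int k + 1) = int (card (proper_colorings S k))"
proof -
  have colors: "signed_colors {0} k = {- int k..int k}" for k
    by (auto simp: signed_colors_def)
  have "finite (verts S)" using assms by (simp add: is_signed_graph_def)
  then obtain p :: "int poly" where
    "\<forall>k\<ge>0. poly p (2 * int k) = int (card {c \<in> verts S \<rightarrow>\<^sub>E signed_colors {0} k. proper S c})"
    using ex_poly_card_colorings[OF _ _ renaming_invariant_proper[OF assms], of "{0}"] by auto
  \<comment> \<open>Here the argument counts zero as a color too, while \<open>p\<close> expects the
    number of nonzero colors, hence the shift by one.\<close>
  then have "\<forall>k. poly (pcompose p [:- 1, 1:]) (2 * int k + 1) = int (card (proper_colorings S k))"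
    by (simp add: proper_colorings_def colors poly_pcompose)
  then have "\<exists>!p. \<forall>k. poly p (2 * int k + 1) = int (card (proper_colorings S k))"
    by (intro ex1I[of _ "pcompose p [:- 1, 1:]"])
      (auto intro!: poly_eqI_infinite[of "\<lambda>k. 2 * int k + 1"] simp: inj_def)
  from theI'[OF this] show ?thesis by (simp add: chromatic_poly_def)
qed

section \<open>The chromatic number via existence of colorings\<close>

lemma chromatic_number_eq:
  assumes "is_signed_graph S"
  shows "chromatic_number S = (LEAST x. x \<in> {2 * k + 1 | k. proper_colorings S k \<noteq> {}}
    \<union> {2 * r | r. proper_zero_free_colorings S r \<noteq> {}})"
proof -
  have "finite (verts S)" using assms by (simp add: is_signed_graph_def)
  then have fin: "finite (proper_colorings S k)" "finite (proper_zero_free_colorings S k)" for k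
    by (simp_all add: proper_colorings_def proper_zero_free_colorings_def finite_PiE)
  have "poly (chromatic_poly S) (int (2 * k + 1)) > 0 \<longleftrightarrow> proper_colorings S k \<noteq> {}" for k
    using poly_chromatic_poly[OF assms, of k] fin by (simp add: card_gt_0_iff add.commute)
  moreover have "poly (zero_free_chromatic_poly S) (int (2 * r)) > 0
      \<longleftrightarrow> proper_zero_free_colorings S r \<noteq> {}" for r
    using poly_zero_free_chromatic_poly[OF assms, of r] fin by (simp add: card_gt_0_iff)
  ultimately show ?thesis by (simp only: chromatic_number_def)
qed

text \<open>An edge excludes 0 and 1: without colors its ends cannot be colored, and if both ends
  get zero then neither sign makes the coloring proper.\<close>

lemma chromatic_number_eq_2_or_3:
  assumes S: "is_signed_graph S" and e: "edges S \<noteq> {}" and three: "proper_colorings S 1 \<noteq> {}"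
  shows "chromatic_number S = (if proper_zero_free_colorings S 1 \<noteq> {} then 2 else 3)"
proof -
  obtain x y where xy: "{x, y} \<in> edges S" "x \<in> verts S" "y \<in> verts S"
  proof -
    obtain d where d: "d \<in> edges S" using e by blast
    then have "card d = 2" "d \<subseteq> verts S" using S by (auto simp: is_signed_graph_def)
    then show ?thesis using d that by (metis card_2_iff insert_subset)
  qed
  have zero: "proper_zero_free_colorings S 0 = {}"
    using xy by (auto simp: proper_zero_free_colorings_def PiE_iff)
  have "\<not> proper S c" if "c \<in> verts S \<rightarrow>\<^sub>E {0}" for c
  proof -
    have "c x = 0" "c y = 0" using that xy by (auto simp: PiE_iff)
    then show ?thesis using xy(1) unfolding proper_def by (metis mult_zero_right)
  qed
  then have one: "proper_colorings S 0 = {}"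
    by (auto simp: proper_colorings_def)
  show ?thesis
    unfolding chromatic_number_eq[OF S]
  proof (rule Least_equality)
    show "(if proper_zero_free_colorings S 1 \<noteq> {} then 2 else 3)
      \<in> {2 * k + 1 | k. proper_colorings S k \<noteq> {}} \<union> {2 * r | r. proper_zero_free_colorings S r \<noteq> {}}"
      using three by (auto intro: exI[of _ "1::nat"])
  next
    fix z assume "z \<in> {2 * k + 1 | k. proper_colorings S k \<noteq> {}}
      \<union> {2 * r | r. proper_zero_free_colorings S r \<noteq> {}}"
    then consider k where "z = 2 * k + 1" "k \<noteq> 0"
      | r where "z = 2 * r" "r \<noteq> 0" "proper_zero_free_colorings S r \<noteq> {}"
      using zero one by force
    then show "(if proper_zero_free_colorings S 1 \<noteq> {} then 2 else 3) \<le> z"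
    proof cases
      case 1
      then show ?thesis by auto
    next
      case 2
      \<comment> \<open>For \<open>r = 1\<close> the conditional evaluates to 2; otherwise
        \<open>z\<close> is at least 4.\<close>
      then show ?thesis by (cases "r = 1") auto
    qed
  qed
qed

section \<open>Colorings of signed books\<close>

text \<open>Each edge appears in one orientation only, which suffices because a sign is its own
  inverse; only edges from \<open>End_u\<close> to a page can be negative.\<close>

lemma proper_signed_book_iff:
  assumes "m \<ge> 3" "l \<le> n"
  shows "proper (signed_book m n l) c \<longleftrightarrow>
    c End_u \<noteq> c End_v \<and>
    (\<forall>i\<in>{1..n}. c End_u \<noteq> (if i \<le> l then - 1 else 1) * c (Page i 1) \<and>
      (\<forall>j\<in>{1..<m - 2}. c (Page i j) \<noteq> c (Page i (j + 1))) \<and> c (Page i (m - 2)) \<noteq> c End_v)"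
    (is "?L \<longleftrightarrow> ?R")
proof -
  have sign: "sign (signed_book m n l) {End_u, Page i 1} = (if i \<le> l then - 1 else 1)" if "i \<in> {1..n}" for i
    using that assms by (auto simp: signed_book_def book_neg_def doubleton_eq_iff)
  show ?thesis
  proof
    assume L: ?L
    have E: "c x \<noteq> sign (signed_book m n l) {x, y} * c y" if "{x, y} \<in> book_edges m n" for x y
      using L that by (simp add: proper_def signed_book_def)
    show ?R
    proof (intro conjI ballI)
      show "c End_u \<noteq> c End_v"
        using E[of End_u End_v]
        by (simp add: book_edges_def signed_book_def book_neg_def doubleton_eq_iff)
      fix i assume i: "i \<in> {1..n}"
      show "c End_u \<noteq> (if i \<le> l then - 1 else 1) * c (Page i 1)"
      proof -
        have "{End_u, Page i 1} \<in> book_edges m n"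
          using i unfolding book_edges_def by blast
        from E[OF this] show ?thesis by (simp only: sign[OF i] not_False_eq_True)
      qed
      show "c (Page i (m - 2)) \<noteq> c End_v"
        using E[of "Page i (m - 2)" End_v] i
        by (auto simp: book_edges_def signed_book_def book_neg_def doubleton_eq_iff)
      fix j assume j: "j \<in> {1..<m - 2}"
      have "{Page i j, Page i (j + 1)} \<in> book_edges m n"
        using i j unfolding book_edges_def by blast
      from E[OF this] show "c (Page i j) \<noteq> c (Page i (j + 1))"
        by (simp add: signed_book_def book_neg_def doubleton_eq_iff)
    qed
  next
    let ?s = "sign (signed_book m n l)"
    assume R: ?R
    \<comment> \<open>The condition is first found in the orientation provided by \<open>?R\<close>
      and then transferred to the other one.\<close>
    have "\<exists>a b. {x, y} = {a, b} \<and> c a \<noteq> ?s {a, b} * c b" if e: "{x, y} \<in> book_edges m n" for x y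
    proof -
      consider "{x, y} = {End_u, End_v}"
        | i where "i \<in> {1..n}" "{x, y} = {End_u, Page i 1}"
        | i j where "i \<in> {1..n}" "j \<in> {1..<m - 2}" "{x, y} = {Page i j, Page i (j + 1)}"
        | i where "i \<in> {1..n}" "{x, y} = {Page i (m - 2), End_v}"
        using e unfolding book_edges_def by blast
      then show ?thesis
      proof cases
        case 1
        moreover have "?s {End_u, End_v} = 1"
          by (simp add: signed_book_def book_neg_def doubleton_eq_iff)
        ultimately show ?thesis using R by (metis mult_1)
      next
        case 2
        then show ?thesis using R sign by metis
      next
        case 3
        moreover have "?s {Page i j, Page i (j + 1)} = 1"
          by (simp add: signed_book_def book_neg_def doubleton_eq_iff)
        ultimately show ?thesis using R by (metis mult_1)
      next
        case 4
        moreover have "?s {Page i (m - 2), End_v} = 1"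
          by (simp add: signed_book_def book_neg_def doubleton_eq_iff)
        ultimately show ?thesis using R by (metis mult_1)
      qed
    qed
    moreover have "?s e = 1 \<or> ?s e = - 1" for e by (simp add: signed_book_def)
    then have "c b \<noteq> ?s {b, a} * c a" if "c a \<noteq> ?s {a, b} * c b" for a b
      using that by (metis insert_commute minus_minus mult_1 mult_minus1)
    ultimately have "c x \<noteq> ?s {x, y} * c y" if "{x, y} \<in> book_edges m n" for x y
      using that by (metis doubleton_eq_iff)
    then show ?L by (simp add: proper_def signed_book_def)
  qed
qed

text \<open>Color \<open>End_v\<close> with \<open>- 1\<close> and alternate along every page. Only
  the edges at \<open>End_u\<close> then constrain \<open>a\<close>, and the hypotheses on
  \<open>a\<close> say exactly that they are satisfied.\<close>

lemma ex_proper_coloring_signed_book: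
  assumes "m \<ge> 3" "l \<le> n" "a \<noteq> - 1"
    and first: "\<And>i. i \<in> {1..n} \<Longrightarrow> a \<noteq> (if i \<le> l then - 1 else 1) * (- 1) ^ (m - 3)"
  obtains c where "c \<in> verts (signed_book m n l) \<rightarrow>\<^sub>E {a, 1, - 1}" "proper (signed_book m n l) c"
proof
  \<comment> \<open>The exponent counts down to 0 at the neighbor of \<open>End_v\<close>, which
    gets 1; the neighbor of \<open>End_u\<close> gets \<open>(- 1) ^ (m - 3)\<close>.\<close>
  let ?c = "\<lambda>x\<in>book_verts m n. case x of End_u \<Rightarrow> a | End_v \<Rightarrow> - 1 | Page i j \<Rightarrow> (- 1 :: int) ^ (m - 2 - j)"
  have pow: "(- 1 :: int) ^ k = 1 \<or> (- 1 :: int) ^ k = - 1" for k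
    by (cases "even k") auto
  show "?c \<in> verts (signed_book m n l) \<rightarrow>\<^sub>E {a, 1, - 1}"
    using pow by (auto simp: signed_book_def split: book_vertex.split)
  have mem: "End_u \<in> book_verts m n" "End_v \<in> book_verts m n"
    "\<And>i j. Page i j \<in> book_verts m n \<longleftrightarrow> i \<in> {1..n} \<and> j \<in> {1..m - 2}"
    by (auto simp: book_verts_def)
  have alt: "(- 1 :: int) ^ (m - 2 - j) \<noteq> (- 1) ^ (m - 2 - (j + 1))" if "j \<in> {1..<m - 2}" for j
  proof -
    have "m - 2 - j = Suc (m - 2 - (j + 1))" using that by auto
    then show ?thesis by simp
  qed
  have c1: "m - 2 - 1 = m - 3" by simp
  have m2: "1 \<le> m - 2" using assms(1) by simp
  show "proper (signed_book m n l) ?c"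
    unfolding proper_signed_book_iff[OF assms(1,2)]
  proof (intro conjI ballI)
    show "?c End_u \<noteq> ?c End_v" using assms(3) mem by simp
    fix i assume i: "i \<in> {1..n}"
    show "?c End_u \<noteq> (if i \<le> l then - 1 else 1) * ?c (Page i 1)"
      using first[OF i] i m2 mem c1 by (simp del: One_nat_def)
    show "?c (Page i (m - 2)) \<noteq> ?c End_v"
      using i m2 mem by (simp del: One_nat_def)
    fix j assume j: "j \<in> {1..<m - 2}"
    show "?c (Page i j) \<noteq> ?c (Page i (j + 1))"
      using alt[OF j] i j mem by simp
  qed
qed

text \<open>With two opposite colors, positive edges flip the color. Hence \<open>End_u\<close>
  agrees with the last inner vertex of page \<open>i\<close>, which is
  \<open>(- 1) ^ (m - 3)\<close> times the first. The edge from \<open>End_u\<close> to the first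
  requires equal colors if negative and opposite ones if positive.\<close>

lemma parity_of_two_coloring_signed_book:
  assumes m: "m \<ge> 3" and l: "l \<le> n" and i: "i \<in> {1..n}"
    and c: "c \<in> proper_zero_free_colorings (signed_book m n l) 1"
  shows "odd m \<longleftrightarrow> i \<le> l"
proof -
  have val: "c x = 1 \<or> c x = - 1" if "x \<in> book_verts m n" for x
  proof -
    have "c x \<in> {- 1..1} - {0}"
      using that c by (auto simp: proper_zero_free_colorings_def signed_book_def PiE_iff)
    then show ?thesis by auto
  qed
  have page: "c (Page i j) = 1 \<or> c (Page i j) = - 1" if "j \<in> {1..m - 2}" for j
    using that i by (intro val) (auto simp: book_verts_def)
  have ends: "c End_u = 1 \<or> c End_u = - 1" "c End_v = 1 \<or> c End_v = - 1"
    by (intro val; simp add: book_verts_def)+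
  have "proper (signed_book m n l) c" using c by (simp add: proper_zero_free_colorings_def)
  note P = this[unfolded proper_signed_book_iff[OF m l]]
  have alt: "Suc j \<le> m - 2 \<Longrightarrow> c (Page i (Suc j)) = (- 1) ^ j * c (Page i 1)" for j
  proof (induction j)
    case 0
    show ?case by simp
  next
    case (Suc j)
    have "c (Page i (Suc j)) \<noteq> c (Page i (Suc (Suc j)))" using P i Suc.prems by auto
    then have "c (Page i (Suc (Suc j))) = - c (Page i (Suc j))"
      using page[of "Suc j"] page[of "Suc (Suc j)"] Suc.prems by auto
    then show ?case using Suc by simp
  qed
  have "Suc (m - 3) = m - 2" using m by simp
  then have last: "c (Page i (m - 2)) = (- 1) ^ (m - 3) * c (Page i 1)"
    using alt[of "m - 3"] by simp
  have page1: "c (Page i 1) = 1 \<or> c (Page i 1) = - 1" using m by (intro page) auto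
  have "even (m - 3) \<longleftrightarrow> odd m" using m by presburger
  moreover have "c End_u \<noteq> c End_v" "c (Page i (m - 2)) \<noteq> c End_v"
    "c End_u \<noteq> (if i \<le> l then - 1 else 1) * c (Page i 1)" using P i by blast+
  ultimately show ?thesis
    using last ends page1 by (cases "odd m"; cases "i \<le> l") auto
qed

theorem theorem2p2:
  fixes m n l :: nat
  assumes "m \<ge> 3" and "n \<ge> 2" and "0 \<le> l" and "l \<le> n"
  shows "chromatic_number (signed_book m n l) =
    (if odd m \<and> l = n then 2
     else if even m \<and> l = 0 then 2
     else 3)"
proof -
  let ?S = "signed_book m n l"
  obtain c where "c \<in> verts ?S \<rightarrow>\<^sub>E {0, 1, - 1}" "proper ?S c"
    \<comment> \<open>Zero at \<open>End_u\<close> differs from every \<open>1\<close> and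
      \<open>- 1\<close>, whatever the parities.\<close>
    by (rule ex_proper_coloring_signed_book[OF assms(1,4), of 0]) auto
  moreover have "{0, 1, - 1} = {- int 1..int 1}" by auto
  ultimately have "c \<in> proper_colorings ?S 1" by (simp add: proper_colorings_def)
  moreover have "edges ?S \<noteq> {}" by (simp add: signed_book_def book_edges_def)
  ultimately have chi: "chromatic_number ?S = (if proper_zero_free_colorings ?S 1 \<noteq> {} then 2 else 3)"
    by (intro chromatic_number_eq_2_or_3 is_signed_graph_signed_book assms(1)) auto
  have "proper_zero_free_colorings ?S 1 \<noteq> {} \<longleftrightarrow> odd m \<and> l = n \<or> even m \<and> l = 0"
  proof
    assume "proper_zero_free_colorings ?S 1 \<noteq> {}"
    then have "odd m \<longleftrightarrow> i \<le> l" if "i \<in> {1..n}" for i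
      using parity_of_two_coloring_signed_book[OF assms(1,4) that] by blast
    \<comment> \<open>Page \<open>n\<close> forces \<open>l = n\<close> for odd \<open>m\<close>,
      and page 1 forces \<open>l = 0\<close> for even \<open>m\<close>.\<close>
    from this[of 1] this[of n] show "odd m \<and> l = n \<or> even m \<and> l = 0" using assms by auto
  next
    assume ml: "odd m \<and> l = n \<or> even m \<and> l = 0"
    have "even (m - 3) \<longleftrightarrow> odd m" using assms(1) by presburger
    \<comment> \<open>In both cases the sign and the parity of the page combine to
      \<open>- 1\<close>, so \<open>End_u\<close> may get 1.\<close>
    then have first: "1 \<noteq> (if i \<le> l then - 1 else 1) * (- 1 :: int) ^ (m - 3)" if "i \<in> {1..n}" for i
      using ml that by auto
    obtain c where "c \<in> verts ?S \<rightarrow>\<^sub>E {1, 1, - 1}" "proper ?S c"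
      by (rule ex_proper_coloring_signed_book[OF assms(1,4), of 1]) (use first in auto)
    moreover have "{1, 1, - 1} = {- int 1..int 1} - {0}" by auto
    ultimately have "c \<in> proper_zero_free_colorings ?S 1" by (simp add: proper_zero_free_colorings_def)
    then show "proper_zero_free_colorings ?S 1 \<noteq> {}" by blast
  qed
  with chi show ?thesis by auto
qed

end
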